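(* For every integer $n\ge 1$, the number of Dyck bridges of semi-length $n$ that have a single highest peak, that start with a hill (i.e. whose first two steps are $\mathtt{u}\mathtt{d}$), and in which each peak of height $h>1$ is preceded by (i.e. has somewhere to its left) a peak of height $h-1$, is equal to the number of irreducible ordered pairs of compositions of $n$.
   Context: A Dyck bridge of semi-length $n$ is a lattice path from $(0,0)$ to $(2n,0)$ with steps $\mathtt{u}=(1,1)$ and $\mathtt{d}=(1,-1)$ (it may go below the $x$-axis). A peak is an occurrence of consecutive steps $\mathtt{u}\mathtt{d}$; its height is the ordinate at which its $\mathtt{u}$ step ends. A hill is a peak of height $1$ starting and ending on the $x$-axis. "Single highest peak" means that exactly one peak attains the maximal height among all peaks. An irreducible ordered pair of compositions of $n$ is an ordered pair of compositions $n=b_1+\dots+b_k=b'_1+\dots+b'_k$ of $n$ into the same number $k\ge 1$ of positive parts such that there is no positive $j<k$ with $b_1+\dots+b_j=b'_1+\dots+b'_j$. *)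

theory Defs
  imports Main
begin

datatype step = U | D

fun rise :: "step \<Rightarrow> int" where
  "rise U = 1"
| "rise D = -1"

text \<open>A lattice path starting at the origin is represented by its word of steps;
  the value below is the ordinate of its final point.\<close>

definition end_height :: "step list \<Rightarrow> int" where
  "end_height w = sum_list (map rise w)"

definition dyck_bridges :: "nat \<Rightarrow> step list set" where
  "dyck_bridges n = {w. length w = 2 * n \<and> end_height w = 0}"

text \<open>A peak is identified by the (0-based) position of its up step.\<close>

definition is_peak :: "step list \<Rightarrow> nat \<Rightarrow> bool" where
  "is_peak w i \<longleftrightarrow> Suc i < length w \<and> w ! i = U \<and> w ! Suc i = D"

definition peak_height :: "step list \<Rightarrow> nat \<Rightarrow> int" where
  "peak_height w i = end_height (take (Suc i) w)"

definition single_highest_peak :: "step list \<Rightarrow> bool" where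
  "single_highest_peak w \<longleftrightarrow>
     (\<exists>!i. is_peak w i \<and> (\<forall>j. is_peak w j \<longrightarrow> peak_height w j \<le> peak_height w i))"

text \<open>A hill is a peak of height 1, so its up step starts and its down step ends on the
  axis.\<close>

definition is_hill :: "step list \<Rightarrow> nat \<Rightarrow> bool" where
  "is_hill w i \<longleftrightarrow> is_peak w i \<and> peak_height w i = 1"

definition starts_with_hill :: "step list \<Rightarrow> bool" where
  "starts_with_hill w \<longleftrightarrow> is_hill w 0"

text \<open>Peaks of height at most 1, which in a bridge may be negative, are unconstrained.\<close>

definition peaks_preceded :: "step list \<Rightarrow> bool" where
  "peaks_preceded w \<longleftrightarrow>
     (\<forall>i. is_peak w i \<and> peak_height w i > 1 \<longrightarrow>
        (\<exists>j<i. is_peak w j \<and> peak_height w j = peak_height w i - 1))"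

definition compositions :: "nat \<Rightarrow> nat list set" where
  "compositions n = {b. (\<forall>x\<in>set b. 0 < x) \<and> sum_list b = n}"

definition irreducible_composition_pairs :: "nat \<Rightarrow> (nat list \<times> nat list) set" where
  "irreducible_composition_pairs n =
     {(b, b'). b \<in> compositions n \<and> b' \<in> compositions n \<and>
        length b = length b' \<and> 1 \<le> length b \<and>
        \<not> (\<exists>j. 0 < j \<and> j < length b \<and> sum_list (take j b) = sum_list (take j b'))}"

end

theory Submission
  imports Defs
begin

text \<open>
  Let \<open>N\<close> be the set of bridges that stay weakly below the axis, and write \<open>a*\<close> for \<open>a\<close> with
  up and down steps exchanged. Cutting an admissible bridge at its first visits of heights 1 and 2
  after the initial hill and at its last visit of height 1 shows that these bridges are generated
  without ambiguity by \<open>X = UD a\<close> or \<open>X = UD a U b X D c\<close> with \<open>a, b, c\<close> in \<open>N\<close>.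

  A pair of compositions is encoded as the word \<open>U^b1 D^b1' U^b2 D^b2' ...\<close>, which is irreducible iff
  the word has no valley on the axis. Cutting such a word at its first two returns to the axis
  and at its next step above the axis gives the unambiguous grammar
  \<open>X = U a* D\<close> or \<open>X = U a* D D b U c X\<close>. Both grammars have the same parse trees, and the two
  words read off from a tree have equal length.
\<close>

section \<open>Paths bounded from above\<close>

lemma end_height_simps [simp]:
  "end_height [] = 0"
  "end_height (s # w) = rise s + end_height w"
  "end_height (v @ w) = end_height v + end_height w"
  by (simp_all add: end_height_def)

lemma end_height_replicate [simp]: "end_height (replicate k s) = int k * rise s"
  by (induction k) (auto simp: algebra_simps)

text \<open>The integer is the room left under a fixed ceiling and is updated by every step. It is
  tested at every point of the path, both ends included, so concatenation splits cleanly.\<close>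

fun below :: "int \<Rightarrow> step list \<Rightarrow> bool" where
  "below m [] \<longleftrightarrow> 0 \<le> m"
| "below m (s # w) \<longleftrightarrow> 0 \<le> m \<and> below (m - rise s) w"

lemma below_nonneg: "below m w \<Longrightarrow> 0 \<le> m"
  by (cases w) auto

lemma not_below_neg [simp]: "m < 0 \<Longrightarrow> \<not> below m w"
  using below_nonneg by fastforce

lemma end_height_le_of_below: "below m w \<Longrightarrow> end_height w \<le> m"
  by (induction w arbitrary: m) fastforce+

lemma below_append [simp]: "below m (v @ w) \<longleftrightarrow> below m v \<and> below (m - end_height v) w"
  by (induction v arbitrary: m) (auto simp: algebra_simps dest: below_nonneg)

lemma below_take: "below m w \<Longrightarrow> end_height (take k w) \<le> m"
  by (metis append_take_drop_id below_append end_height_le_of_below)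

lemma below_mono: "below m w \<Longrightarrow> m \<le> m' \<Longrightarrow> below m' w"
  by (induction w arbitrary: m m') fastforce+

text \<open>The cut is made just before the first step that breaks through the ceiling
  \<open>m\<close>. In both grammars this is how the nonpositive pieces are split off from the
  left.\<close>

lemma first_passage:
  assumes "\<not> below m w" "0 \<le> m"
  obtains v r where "w = v @ U # r" "below m v" "end_height v = m"
proof -
  have "\<exists>v r. w = v @ U # r \<and> below m v \<and> end_height v = m"
    using assms
  proof (induction w arbitrary: m)
    case (Cons s w)
    show ?case
    proof (cases "0 \<le> m - rise s")
      case True
      then obtain v r where "w = v @ U # r" "below (m - rise s) v" "end_height v = m - rise s"
        using Cons by force
      then show ?thesis using Cons.prems by (intro exI[of _ "s # v"] exI[of _ r]) auto
    next
      case False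
      then have "s = U" "m = 0" using Cons.prems by (cases s; simp)+
      then show ?thesis by (intro exI[of _ "[]"] exI[of _ w]) auto
    qed
  qed simp
  then show ?thesis using that by blast
qed

text \<open>The cut is made at the last step leaving height 0 downwards; afterwards the path never
  exceeds -1, which is height 0 relative to the start of \<open>r\<close>.\<close>

lemma last_passage:
  assumes "end_height w = - 1"
  obtains v r where "w = v @ D # r" "end_height v = 0" "below 0 r"
proof -
  have "\<exists>v r. w = v @ D # r \<and> end_height v = 0 \<and> below 0 r"
    \<comment> \<open>Any negative final height is allowed, since removing the last step changes
      that height during the induction from the right.\<close>
    if "end_height w \<le> - 1" for w
    using that
  proof (induction w rule: rev_induct)
    case (snoc s w)
    show ?case
    proof (cases "end_height w \<le> - 1")
      case True
      then obtain v r where "w = v @ D # r" "end_height v = 0" "below 0 r"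
        using snoc by blast
      then show ?thesis
        using snoc.prems by (intro exI[of _ v] exI[of _ "r @ [s]"]) (auto dest: end_height_le_of_below)
    next
      case False
      then have "s = D" "end_height w = 0" using snoc.prems by (cases s; simp)+
      then show ?thesis by (intro exI[of _ w] exI[of _ "[]"]) auto
    qed
  qed simp
  then show ?thesis using assms that by (metis order_refl)
qed

section \<open>Bridges weakly below the axis and the uniqueness of cuts next to them\<close>

definition nonpos_bridge :: "step list \<Rightarrow> bool" where
  "nonpos_bridge w \<longleftrightarrow> end_height w = 0 \<and> below 0 w"

text \<open>The displayed U is the first step rising above the starting level, so its position is
  determined by the whole word.\<close>

lemma nonpos_bridge_append_U_inject:
  assumes "v @ U # r = v' @ U # r'" "nonpos_bridge v" "nonpos_bridge v'"
  shows "v = v' \<and> r = r'"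
  using assms
  by (auto simp: nonpos_bridge_def append_eq_append_conv2 append_eq_Cons_conv Cons_eq_append_conv)

text \<open>Here \<open>v\<close> may be arbitrary above and below the axis: the displayed D starts
  at the last visit of height 0, because \<open>r\<close> stays at height -1 or lower.\<close>

lemma append_D_nonpos_bridge_inject:
  assumes "v @ D # r = v' @ D # r'" "end_height v = 0" "end_height v' = 0"
    "nonpos_bridge r" "nonpos_bridge r'"
  shows "v = v' \<and> r = r'"
  using assms
  by (auto simp: nonpos_bridge_def append_eq_append_conv2 append_eq_Cons_conv Cons_eq_append_conv)

fun flip :: "step \<Rightarrow> step" where
  "flip U = D"
| "flip D = U"

lemma flip_flip [simp]: "flip (flip s) = s"
  by (cases s) auto

lemma map_flip_flip [simp]: "map flip (map flip w) = w"
  by (induction w) auto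

lemma end_height_map_flip [simp]: "end_height (map flip w) = - end_height w"
proof (induction w)
  case (Cons s w)
  then show ?case by (cases s) auto
qed simp

text \<open>Mirror image of \<open>nonpos_bridge_append_U_inject\<close>: the displayed D is the
  first step falling below the starting level.\<close>

lemma map_flip_append_D_inject:
  assumes "map flip v @ D # r = map flip v' @ D # r'" "nonpos_bridge v" "nonpos_bridge v'"
  shows "v = v' \<and> r = r'"
proof -
  have "v @ U # map flip r = v' @ U # map flip r'"
    using arg_cong[OF assms(1), of "map flip"] by (simp del: map_map)
  then have "v = v'" "map flip r = map flip r'"
    using nonpos_bridge_append_U_inject assms(2,3) by blast+
  then show ?thesis by (metis map_flip_flip)
qed

section \<open>Parse trees\<close>

datatype parse = Last "step list" | More "step list" "step list" "step list" parse

fun valid :: "parse \<Rightarrow> bool" where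
  "valid (Last a) \<longleftrightarrow> nonpos_bridge a"
| "valid (More a b c t) \<longleftrightarrow> nonpos_bridge a \<and> nonpos_bridge b \<and> nonpos_bridge c \<and> valid t"

fun bridge_of :: "parse \<Rightarrow> step list" where
  "bridge_of (Last a) = U # D # a"
| "bridge_of (More a b c t) = (U # D # a @ U # b) @ bridge_of t @ D # c"

text \<open>In \<open>More\<close>, flipped \<open>a\<close> stays at height 1 or more, so the D
  after it is the first return to the axis; the U after \<open>b\<close> is the second, and
  \<open>c\<close> ends where the recursive word first rises above the axis.\<close>

fun ud_word_of :: "parse \<Rightarrow> step list" where
  "ud_word_of (Last a) = U # map flip a @ [D]"
| "ud_word_of (More a b c t) = U # map flip a @ D # D # b @ U # c @ ud_word_of t"

lemma length_ud_word_of: "length (ud_word_of t) = length (bridge_of t)"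
  by (induction t) auto

lemma end_height_bridge_of [simp]: "valid t \<Longrightarrow> end_height (bridge_of t) = 0"
  by (induction t) (auto simp: nonpos_bridge_def)

lemma end_height_ud_word_of [simp]: "valid t \<Longrightarrow> end_height (ud_word_of t) = 0"
  by (induction t) (auto simp: nonpos_bridge_def)

text \<open>The recursive word follows \<open>b\<close> directly, so the end of \<open>b\<close> is
  recognisable only through the initial U of that word. For \<open>c\<close>,
  \<open>ud_word_of_eq_Cons\<close> does the same.\<close>

lemma bridge_of_eq_Cons: "\<exists>r. bridge_of t = U # D # r"
  by (cases t) auto

lemma ud_word_of_eq_Cons: "\<exists>r. ud_word_of t = U # r"
  by (cases t) auto

text \<open>Separates the two productions: after the initial hill, a \<open>More\<close> bridge
  rises above the axis and a \<open>Last\<close> bridge does not.\<close>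

lemma nonpos_bridge_ne_append_U: "nonpos_bridge v \<Longrightarrow> \<not> nonpos_bridge (v @ U # r)"
  by (auto simp: nonpos_bridge_def)

text \<open>The tree is read off from both ends: first passages give \<open>a\<close> and
  \<open>b\<close> from the left, a last passage gives \<open>c\<close> from the right, and the
  middle is the word of the subtree.\<close>

lemma inj_on_bridge_of: "inj_on bridge_of (Collect valid)"
proof -
  have "t = t'" if "valid t" "valid t'" "bridge_of t = bridge_of t'" for t t'
    using that
  proof (induction t arbitrary: t')
    case (Last a)
    then show ?case
      by (cases t') (auto dest: nonpos_bridge_ne_append_U)
  next
    case (More a b c t)
    show ?case
    proof (cases t')
      case (Last a')
      then show ?thesis using More.prems nonpos_bridge_ne_append_U by auto
    next
      case (More a' b' c' u)
      have eq: "a @ U # (b @ bridge_of t @ D # c) = a' @ U # (b' @ bridge_of u @ D # c')"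
        using More More.prems by simp
      have val: "nonpos_bridge a" "nonpos_bridge b" "nonpos_bridge c" "valid t"
        "nonpos_bridge a'" "nonpos_bridge b'" "nonpos_bridge c'" "valid u"
        using More More.prems by auto
      have a: "a = a'" and eq2: "b @ bridge_of t @ D # c = b' @ bridge_of u @ D # c'"
        using nonpos_bridge_append_U_inject[OF eq] val by auto
      obtain r r' where r: "bridge_of t = U # r" "bridge_of u = U # r'"
        using bridge_of_eq_Cons by metis
      have "b @ U # (r @ D # c) = b' @ U # (r' @ D # c')"
        using eq2 r by simp
      then have b: "b = b'" and "r @ D # c = r' @ D # c'"
        using nonpos_bridge_append_U_inject val by blast+
      then have "bridge_of t @ D # c = bridge_of u @ D # c'"
        using r by simp
      then have "bridge_of t = bridge_of u" "c = c'"
        using append_D_nonpos_bridge_inject val end_height_bridge_of by blast+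
      then show ?thesis using More.IH val a b More by auto
    qed
  qed
  then show ?thesis by (auto simp: inj_on_def)
qed

text \<open>All pieces are read off from the left. The word of a \<open>Last\<close> tree ends at
  its first return to the axis, that of a \<open>More\<close> tree does not.\<close>

lemma inj_on_ud_word_of: "inj_on ud_word_of (Collect valid)"
proof -
  have "t = t'" if "valid t" "valid t'" "ud_word_of t = ud_word_of t'" for t t'
    using that
  proof (induction t arbitrary: t')
    case (Last a)
    then show ?case
    proof (cases t')
      case (Last a')
      then show ?thesis using Last.prems map_flip_append_D_inject[of a "[]" a' "[]"] by auto
    next
      case (More a' b' c' u)
      then show ?thesis
        using Last.prems map_flip_append_D_inject[of a "[]" a' "D # b' @ U # c' @ ud_word_of u"]
        by auto
    qed
  next
    case (More a b c t)
    show ?case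
    proof (cases t')
      case (Last a')
      then show ?thesis
        using More.prems map_flip_append_D_inject[of a "D # b @ U # c @ ud_word_of t" a' "[]"]
        by auto
    next
      case (More a' b' c' u)
      have eq: "map flip a @ D # (D # b @ U # c @ ud_word_of t) =
                map flip a' @ D # (D # b' @ U # c' @ ud_word_of u)"
        using More More.prems by simp
      have val: "nonpos_bridge a" "nonpos_bridge b" "nonpos_bridge c" "valid t"
        "nonpos_bridge a'" "nonpos_bridge b'" "nonpos_bridge c'" "valid u"
        using More More.prems by auto
      have a: "a = a'" and eq2: "b @ U # (c @ ud_word_of t) = b' @ U # (c' @ ud_word_of u)"
        using map_flip_append_D_inject[OF eq] val by auto
      have b: "b = b'" and eq3: "c @ ud_word_of t = c' @ ud_word_of u"
        using nonpos_bridge_append_U_inject[OF eq2] val by auto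
      obtain r r' where r: "ud_word_of t = U # r" "ud_word_of u = U # r'"
        using ud_word_of_eq_Cons by metis
      then have "c = c'" "r = r'"
        using nonpos_bridge_append_U_inject[of c r c' r'] eq3 val by auto
      then show ?thesis using More.IH val a b More r by auto
    qed
  qed
  then show ?thesis by (auto simp: inj_on_def)
qed

section \<open>Bridges with a single highest peak\<close>

definition admissible :: "step list \<Rightarrow> bool" where
  "admissible w \<longleftrightarrow> single_highest_peak w \<and> starts_with_hill w \<and> peaks_preceded w"

lemma starts_with_hill_iff: "starts_with_hill w \<longleftrightarrow> (\<exists>r. w = U # D # r)"
proof (cases w)
  case (Cons s v)
  then show ?thesis
    by (cases v) (auto simp: starts_with_hill_def is_hill_def is_peak_def peak_height_def)
qed (simp add: starts_with_hill_def is_hill_def is_peak_def)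

text \<open>Neither \<open>p\<close> nor \<open>q\<close> rises above height 1 in the whole path, so
  every peak higher than that lies inside \<open>v\<close>, where it is one unit lower.\<close>

lemma high_peaks_shift:
  assumes "below 1 p" "end_height p = 1" "end_height v = 0" "below 0 q"
  shows "is_peak (p @ v @ q) i \<and> peak_height (p @ v @ q) i > 1 \<longleftrightarrow>
    (\<exists>j. i = length p + j \<and> is_peak v j \<and> peak_height v j > 0)"
    (is "?l \<longleftrightarrow> ?r")
proof
  assume l: ?l
  have "length p \<le> i"
  proof (rule ccontr)
    assume "\<not> length p \<le> i"
    then have "peak_height (p @ v @ q) i \<le> 1"
      using below_take[OF assms(1), of "Suc i"] by (simp add: peak_height_def)
    then show False using l by simp
  qed
  then obtain j where j: "i = length p + j" using le_Suc_ex by blast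
  have h: "peak_height (p @ v @ q) i
      = 1 + end_height (take (Suc j) v) + end_height (take (Suc j - length v) q)"
    using assms(2) by (simp add: peak_height_def j)
  \<comment> \<open>A peak formed by the last step of \<open>v\<close> and the first step of
    \<open>q\<close> has its top at height exactly 1, and all later points are no higher.\<close>
  have "Suc j < length v"
  proof (rule ccontr)
    assume "\<not> Suc j < length v"
    then have "peak_height (p @ v @ q) i \<le> 1"
      using h assms(3) below_take[OF assms(4)] by simp
    then show False using l by simp
  qed
  then show ?r using l h j by (auto simp: is_peak_def nth_append peak_height_def)
next
  assume ?r
  then obtain j where "i = length p + j" "is_peak v j" "peak_height v j > 0" by blast
  then show ?l using assms(2) by (auto simp: is_peak_def nth_append peak_height_def)
qed

lemma peak_height_shift:
  "is_peak v j \<Longrightarrow> peak_height (p @ v @ q) (length p + j) = end_height p + peak_height v j"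
  by (auto simp: is_peak_def peak_height_def)

text \<open>Once some peak exceeds \<open>m\<close>, peaks of height at most \<open>m\<close> cannot
  be maximal. This allows comparing only the peaks matched by
  \<open>high_peaks_shift\<close>.\<close>

lemma single_highest_peak_above:
  assumes "is_peak w i0" "peak_height w i0 > m"
  shows "single_highest_peak w \<longleftrightarrow>
    (\<exists>!i. (is_peak w i \<and> peak_height w i > m) \<and>
       (\<forall>j. is_peak w j \<and> peak_height w j > m \<longrightarrow> peak_height w j \<le> peak_height w i))"
  unfolding single_highest_peak_def
proof (rule arg_cong[where f = Ex1], rule ext)
  fix i
  show "(is_peak w i \<and> (\<forall>j. is_peak w j \<longrightarrow> peak_height w j \<le> peak_height w i)) \<longleftrightarrow>
    ((is_peak w i \<and> peak_height w i > m) \<and>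
       (\<forall>j. is_peak w j \<and> peak_height w j > m \<longrightarrow> peak_height w j \<le> peak_height w i))"
    using assms by (smt (verit, best))
qed

lemma ex1_shift: "(\<exists>!i. \<exists>k. i = l + k \<and> Q k) \<longleftrightarrow> (\<exists>!k. Q k)" for l :: nat
  by (metis add_left_cancel)

text \<open>The induction step for bridges: lifting \<open>v\<close> by one unit preserves the order
  among its positive peaks, and the first hill of \<open>v\<close> guarantees that there is
  one.\<close>

lemma admissible_shift:
  assumes p: "below 1 p" "end_height p = 1" "p = U # D # p'"
    and v: "end_height v = 0" "v = U # D # v'" and q: "below 0 q"
  shows "admissible (p @ v @ q) \<longleftrightarrow> admissible v"
proof -
  let ?w = "p @ v @ q" and ?l = "length p"
  note high = high_peaks_shift[OF p(1,2) v(1) q]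
  have high_v: "is_peak ?w (?l + j)" "peak_height ?w (?l + j) = 1 + peak_height v j"
    if "is_peak v j" "peak_height v j > 0" for j
    using that high[of "?l + j"] peak_height_shift[of v j p q] p(2) by auto
  have v0: "is_peak v 0" "peak_height v 0 = 1"
    using v(2) by (auto simp: is_peak_def peak_height_def)
  have w0: "is_peak ?w 0" "peak_height ?w 0 = 1"
    using p(3) by (auto simp: is_peak_def peak_height_def)
  have "single_highest_peak ?w \<longleftrightarrow>
    (\<exists>!i. (is_peak ?w i \<and> peak_height ?w i > 1) \<and>
       (\<forall>j. is_peak ?w j \<and> peak_height ?w j > 1 \<longrightarrow> peak_height ?w j \<le> peak_height ?w i))"
    using high_v[OF v0(1)] v0 by (intro single_highest_peak_above[of _ "?l + 0"]) auto
  also have "\<dots> \<longleftrightarrow> (\<exists>!i. (is_peak v i \<and> peak_height v i > 0) \<and>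
       (\<forall>j. is_peak v j \<and> peak_height v j > 0 \<longrightarrow> peak_height v j \<le> peak_height v i))"
    (is "?A \<longleftrightarrow> ?B")
  proof -
    let ?P = "\<lambda>i. (is_peak ?w i \<and> peak_height ?w i > 1) \<and>
       (\<forall>j. is_peak ?w j \<and> peak_height ?w j > 1 \<longrightarrow> peak_height ?w j \<le> peak_height ?w i)"
    let ?Q = "\<lambda>i. (is_peak v i \<and> peak_height v i > 0) \<and>
       (\<forall>j. is_peak v j \<and> peak_height v j > 0 \<longrightarrow> peak_height v j \<le> peak_height v i)"
    have shift: "?P i \<longleftrightarrow> (\<exists>k. i = ?l + k \<and> ?Q k)" for i
    proof -
      have "?P i \<longleftrightarrow> (\<exists>k. i = ?l + k \<and> is_peak v k \<and> peak_height v k > 0) \<and>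
        (\<forall>j. (\<exists>k. j = ?l + k \<and> is_peak v k \<and> peak_height v k > 0) \<longrightarrow>
          peak_height ?w j \<le> peak_height ?w i)"
        by (simp only: high)
      also have "\<dots> \<longleftrightarrow> (\<exists>k. i = ?l + k \<and> (is_peak v k \<and> peak_height v k > 0) \<and>
        (\<forall>j. is_peak v j \<and> peak_height v j > 0 \<longrightarrow>
          peak_height ?w (?l + j) \<le> peak_height ?w (?l + k)))"
        by blast
      also have "\<dots> \<longleftrightarrow> (\<exists>k. i = ?l + k \<and> ?Q k)"
        by (auto simp: high_v)
      finally show ?thesis .
    qed
    show ?thesis
      unfolding shift by (rule ex1_shift)
  qed
  also have "\<dots> \<longleftrightarrow> single_highest_peak v"
    using v0 by (intro single_highest_peak_above[symmetric, of _ 0]) auto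
  finally have single: "single_highest_peak ?w \<longleftrightarrow> single_highest_peak v" .
  have "peaks_preceded ?w \<longleftrightarrow> peaks_preceded v"
  proof
    assume w: "peaks_preceded ?w"
    show "peaks_preceded v"
      unfolding peaks_preceded_def
    proof (intro allI impI)
      fix i assume i: "is_peak v i \<and> peak_height v i > 1"
      then have wi: "is_peak ?w (?l + i)" "peak_height ?w (?l + i) = 1 + peak_height v i"
        using high_v by auto
      then obtain j where j: "j < ?l + i" "is_peak ?w j" "peak_height ?w j = peak_height v i"
        using w i unfolding peaks_preceded_def by fastforce
      \<comment> \<open>The preceding peak of \<open>?w\<close> still has height above 1, so it
        comes from \<open>v\<close> and not from \<open>p\<close>.\<close>
      then obtain k where "j = ?l + k" "is_peak v k" "peak_height v k > 0"
        using high[of j] i by auto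
      then show "\<exists>j<i. is_peak v j \<and> peak_height v j = peak_height v i - 1"
        using j high_v[of k] by auto
    qed
  next
    assume pv: "peaks_preceded v"
    show "peaks_preceded ?w"
      unfolding peaks_preceded_def
    proof (intro allI impI)
      fix i assume "is_peak ?w i \<and> peak_height ?w i > 1"
      then obtain k where k: "i = ?l + k" "is_peak v k" "peak_height v k > 0"
        using high by auto
      show "\<exists>j<i. is_peak ?w j \<and> peak_height ?w j = peak_height ?w i - 1"
      proof (cases "peak_height v k > 1")
        case True
        then obtain j where "j < k" "is_peak v j" "peak_height v j = peak_height v k - 1"
          using pv k unfolding peaks_preceded_def by blast
        then show ?thesis using True k high_v[of j] high_v[of k]
          by (intro exI[of _ "?l + j"]) auto
      next
        \<comment> \<open>A peak of height 1 in \<open>v\<close> becomes one of height 2, which is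
          newly constrained; the initial hill of \<open>p\<close> precedes it.\<close>
        case False
        then show ?thesis using k high_v[of k] w0 p(3) by (intro exI[of _ 0]) auto
      qed
    qed
  qed
  then show ?thesis
    using single p(3) v(2) by (auto simp: admissible_def starts_with_hill_iff)
qed

text \<open>The initial hill is the only peak of positive height, so it is the unique highest one
  and no peak exceeds height 1.\<close>

lemma admissible_hill_nonpos:
  assumes "below 0 a"
  shows "admissible (U # D # a)"
proof -
  let ?w = "U # D # a"
  have 0: "is_peak ?w 0" "peak_height ?w 0 = 1"
    by (auto simp: is_peak_def peak_height_def)
  have "peak_height ?w i \<le> 0" if "is_peak ?w i" "i \<noteq> 0" for i
  proof -
    have "i \<noteq> 1" using that by (auto simp: is_peak_def)
    then obtain k where "i = Suc (Suc k)" using \<open>i \<noteq> 0\<close> by (cases i; cases "i - 1") auto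
    then show ?thesis using below_take[OF assms, of "Suc k"] by (simp add: peak_height_def)
  qed
  then have *: "i = 0 \<or> peak_height ?w i \<le> 0" if "is_peak ?w i" for i
    using that by blast
  have "single_highest_peak ?w"
    unfolding single_highest_peak_def
  proof (rule ex1I[of _ 0])
    show "is_peak ?w 0 \<and> (\<forall>j. is_peak ?w j \<longrightarrow> peak_height ?w j \<le> peak_height ?w 0)"
      using 0 * by fastforce
  next
    fix i assume "is_peak ?w i \<and> (\<forall>j. is_peak ?w j \<longrightarrow> peak_height ?w j \<le> peak_height ?w i)"
    then show "i = 0" using 0 * by fastforce
  qed
  moreover have "peaks_preceded ?w"
    unfolding peaks_preceded_def using 0 * by fastforce
  ultimately show ?thesis by (simp add: admissible_def starts_with_hill_iff)
qed

lemma admissible_bridge_of: "valid t \<Longrightarrow> admissible (bridge_of t)"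
proof (induction t)
  case (Last a)
  then show ?case by (simp add: nonpos_bridge_def admissible_hill_nonpos)
next
  case (More a b c t)
  obtain r where r: "bridge_of t = U # D # r" using bridge_of_eq_Cons by blast
  have "below 1 a" using More.prems below_mono[of 0 a 1] by (simp add: nonpos_bridge_def)
  then have "admissible ((U # D # a @ U # b) @ bridge_of t @ D # c) \<longleftrightarrow> admissible (bridge_of t)"
    using More.prems below_mono[of 0 c 1] r end_height_bridge_of[of t]
    by (intro admissible_shift[of _ "a @ U # b" _ r])
      (auto simp: nonpos_bridge_def simp del: end_height_bridge_of)
  then show ?case using More by simp
qed

section \<open>Decomposition of admissible bridges\<close>

lemma append_replicate_U_cases:
  obtains k where "w = replicate k U" | k r where "w = replicate k U @ D # r"
proof -
  have "(\<exists>k. w = replicate k U) \<or> (\<exists>k r. w = replicate k U @ D # r)"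
  proof (induction w)
    case (Cons s w)
    show ?case
    proof (cases s)
      case U
      then show ?thesis using Cons by (metis append_Cons replicate_Suc)
    next
      case D
      then show ?thesis by (metis append_Nil replicate_0)
    qed
  qed simp
  then show ?thesis using that by blast
qed

text \<open>The first ascent above height 1 must stop at height 2: a longer run would end in a peak
  with no earlier peak one unit lower.\<close>

lemma admissible_first_ascent:
  assumes "admissible w" "end_height w = 0" "w = p @ U # r" "below 1 p" "end_height p = 1"
  shows "\<exists>r'. r = D # r'"
proof (cases rule: append_replicate_U_cases[of r])
  case (1 k)
  then show ?thesis using assms by simp
next
  case (2 k r')
  show ?thesis
  proof (cases k)
    case (Suc m)
    \<comment> \<open>Position of the last U in the run that consists of the displayed U and
      \<open>k\<close> further ones.\<close>
    let ?i = "length p + k"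
    have w: "w = p @ replicate (Suc k) U @ D # r'"
      using 2 assms(3) by simp
    have "is_peak w ?i"
      unfolding w is_peak_def by (auto simp: nth_append nth_Cons')
    moreover have hi: "peak_height w ?i = int k + 2"
      using assms(5) by (simp add: w peak_height_def)
    ultimately obtain j where j: "j < ?i" "is_peak w j" "peak_height w j = int k + 1"
      using assms(1) unfolding admissible_def peaks_preceded_def by force
    \<comment> \<open>A peak with its top in \<open>p\<close> has height at most 1, but
      \<open>k + 1\<close> is at least 2. So \<open>j\<close> lies in the run, where the next step
      is again U.\<close>
    have "\<not> Suc j \<le> length p"
      using below_take[OF assms(4), of "Suc j"] j Suc by (auto simp: w peak_height_def)
    then have "w ! Suc j = U"
      using j(1) unfolding w by (auto simp: nth_append simp del: replicate_Suc)
    then show ?thesis using j(2) by (simp add: is_peak_def)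
  qed (use 2 in simp)
qed

lemma admissible_imp_bridge_of:
  "admissible w \<Longrightarrow> end_height w = 0 \<Longrightarrow> \<exists>t. valid t \<and> w = bridge_of t"
proof (induction w rule: length_induct)
  case (1 w)
  obtain r where r: "w = U # D # r"
    using 1(2) by (auto simp: admissible_def starts_with_hill_iff)
  show ?case
  proof (cases "below 0 r")
    case True
    then show ?thesis
      using 1(3) r by (intro exI[of _ "Last r"]) (auto simp: nonpos_bridge_def)
  next
    case False
    then obtain a s where a: "r = a @ U # s" "below 0 a" "end_height a = 0"
      using first_passage by (metis order_refl)
    \<comment> \<open>If the path never rose above height 1, the step after \<open>a\<close> would
      create a second peak of height 1, tied with the initial hill.\<close>
    have "\<not> below 0 s"
    proof
      assume s: "below 0 s"
      let ?i = "length (U # D # a)"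
      have "s \<noteq> []" using a r 1(3) by auto
      then obtain s' where s': "s = D # s'"
        using s by (metis below.simps(2) below_nonneg diff_0 le_minus_one_simps(3) list.exhaust
            rise.simps(1) step.exhaust)
      have "is_peak w ?i" "peak_height w ?i = 1"
        using a by (auto simp: r s' is_peak_def peak_height_def nth_append)
      moreover have "is_peak w 0" "peak_height w 0 = 1"
        by (auto simp: r is_peak_def peak_height_def)
      moreover have "below 1 w"
        using a s below_mono[of 0 a 1] by (simp add: r)
      then have "peak_height w j \<le> 1" for j
        using below_take by (simp add: peak_height_def)
      ultimately show False
        using 1(2) unfolding admissible_def single_highest_peak_def
        by (metis length_0_conv list.distinct(1))
    qed
    then obtain b s1 where b: "s = b @ U # s1" "below 0 b" "end_height b = 0"
      using first_passage by (metis order_refl)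
    let ?p = "U # D # a @ U # b"
    have p: "below 1 ?p" "end_height ?p = 1" "w = ?p @ U # s1"
      using a b r below_mono[of 0 a 1] by auto
    then obtain s2 where s2: "s1 = D # s2"
      using admissible_first_ascent 1(2,3) by blast
    \<comment> \<open>Seen from height 1 the remaining path ends at -1. Its last visit of height 1
      separates the recursive bridge from the tail \<open>D # c\<close>.\<close>
    then have "end_height (U # D # s2) = - 1"
      using p 1(3) by simp
    then obtain v c where v: "U # D # s2 = v @ D # c" "end_height v = 0" "below 0 c"
      using last_passage by metis
    have c: "end_height c = 0"
      using arg_cong[OF v(1), of end_height] v(2) \<open>end_height (U # D # s2) = - 1\<close> by simp
    obtain v' where v': "v = U # D # v'"
      using v(1,2) by (cases v; cases "tl v") auto
    have w: "w = ?p @ v @ D # c"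
      using p(3) s2 v(1) by simp
    have "below 0 (D # c)" using v(3) below_mono[of 0 c 1] by simp
    then have "admissible v"
      using admissible_shift[OF p(1,2) _ v(2) v'] 1(2) w by blast
    moreover have "length v < length w" using w by simp
    ultimately obtain t where t: "valid t" "v = bridge_of t"
      using 1(1) v(2) by blast
    show ?thesis
      using t a b c v(3) w
      by (intro exI[of _ "More a b c t"]) (auto simp: nonpos_bridge_def)
  qed
qed

section \<open>Irreducible words\<close>

text \<open>These are the words coding nonempty pairs of equally long lists of positive parts. The
  final height is left free.\<close>

definition ud_word :: "step list \<Rightarrow> bool" where
  "ud_word w \<longleftrightarrow> w \<noteq> [] \<and> hd w = U \<and> last w = D"

text \<open>A forbidden factorisation is a valley on the axis: \<open>x\<close> arrives there by D
  and \<open>y\<close> leaves by U.\<close>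

definition irreducible_word :: "step list \<Rightarrow> bool" where
  "irreducible_word w \<longleftrightarrow> ud_word w \<and> end_height w = 0 \<and>
     \<not> (\<exists>x y. w = x @ y \<and> ud_word x \<and> ud_word y \<and> end_height x = 0)"

lemma ud_word_ud_word_of: "ud_word (ud_word_of t)"
proof (induction t)
  case (More a b c t)
  then show ?case by (auto simp: ud_word_def)
qed (simp add: ud_word_def)

text \<open>A final D arriving at height 0 would come from height 1, above the ceiling.\<close>

lemma nonpos_not_last_D: "below 0 (x @ y) \<Longrightarrow> end_height x = 0 \<Longrightarrow> x \<noteq> [] \<Longrightarrow> last x \<noteq> D"
  by (cases x rule: rev_cases) (auto dest: end_height_le_of_below)

text \<open>A valley on the axis is pushed rightwards through the pieces: the first return continues
  with D, the second is reached by U, and within \<open>c\<close> the axis is only reached from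
  below. The valley thus lies in the recursive word.\<close>

lemma irreducible_ud_word_of: "valid t \<Longrightarrow> irreducible_word (ud_word_of t)"
proof -
  \<comment> \<open>Flipped \<open>a\<close> never drops below height 1, so a nonempty prefix back
    at height 0 contains the whole first block.\<close>
  have first: "\<exists>z. x = U # map flip a @ D # z \<and> z @ y = r \<and> end_height z = 0"
    if prems: "nonpos_bridge a" "U # map flip a @ D # r = x @ y" "x \<noteq> []" "end_height x = 0"
    for a r x y
  proof -
    obtain v where v: "x = U # v" "map flip a @ D # r = v @ y" "end_height v = - 1"
      using prems by (cases x) auto
    from v(2) consider z where "map flip a = v @ z"
      | z where "v = map flip a @ z" "z @ y = D # r"
      by (auto simp: append_eq_append_conv2)
    then show ?thesis
    proof cases
      case (1 z)
      then have "a = map flip v @ map flip z" by (metis map_append map_flip_flip)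
      then have "end_height (map flip v) \<le> 0"
        using prems(1) end_height_le_of_below[of 0 "map flip v"]
        by (simp add: nonpos_bridge_def del: end_height_map_flip)
      then show ?thesis using v(3) by simp
    next
      case (2 z)
      then show ?thesis
        using v prems(1) by (cases z) (auto simp: nonpos_bridge_def)
    qed
  qed
  have "\<not> (\<exists>x y. ud_word_of t = x @ y \<and> ud_word x \<and> ud_word y \<and> end_height x = 0)" if "valid t"
    using that
  proof (induction t)
    case (Last a)
    then show ?case using first[of a "[]"] by (auto simp: ud_word_def)
  next
    case (More a b c t)
    show ?case
    proof
      assume "\<exists>x y. ud_word_of (More a b c t) = x @ y \<and> ud_word x \<and> ud_word y \<and> end_height x = 0"
      then obtain x y where xy: "U # map flip a @ D # (D # b @ U # c @ ud_word_of t) = x @ y"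
        "ud_word x" "ud_word y" "end_height x = 0" by auto
      then obtain z where z: "x = U # map flip a @ D # z" "z @ y = D # b @ U # c @ ud_word_of t"
        "end_height z = 0"
        using first[of a _ x y] More.prems by (auto simp: ud_word_def)
      have "z \<noteq> []" using z(2) xy(3) by (auto simp: ud_word_def)
      then obtain z1 where z1: "z = D # z1" "z1 @ y = b @ U # c @ ud_word_of t" "end_height z1 = 1"
        using z by (cases z) auto
      have b: "end_height b = 0" "below 0 b" using More.prems by (auto simp: nonpos_bridge_def)
      have c: "end_height c = 0" "below 0 c" using More.prems by (auto simp: nonpos_bridge_def)
      from z1(2) consider z2 where "b = z1 @ z2"
        | z2 where "z1 = b @ z2" "z2 @ y = U # c @ ud_word_of t"
        by (auto simp: append_eq_append_conv2)
      then obtain z2 where z2: "z1 = b @ z2" "z2 @ y = U # c @ ud_word_of t"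
        using z1(3) b end_height_le_of_below by (cases) force+
      moreover have "z2 \<noteq> []" using z1(3) z2(1) b by auto
      ultimately obtain z3 where z3: "z2 = U # z3" "z3 @ y = c @ ud_word_of t"
        by (cases z2) auto
      have h: "end_height z3 = 0" using z1(3) z2(1) z3(1) b by simp
      have l: "z3 \<noteq> []" "last z3 = D"
        using xy(2) unfolding z(1) z1(1) z2(1) z3(1) ud_word_def by (auto split: if_splits)
      have nc: "\<not> (\<exists>e. c = z3 @ e)" using nonpos_not_last_D h l c by blast
      then obtain e where e: "z3 = c @ e" "e @ y = ud_word_of t"
        using z3(2) by (auto simp: append_eq_append_conv2)
      moreover have "e \<noteq> []" using nc e(1) by auto
      moreover have "hd e = U" using e(2) \<open>e \<noteq> []\<close> ud_word_ud_word_of[of t]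
        by (auto simp: ud_word_def hd_append simp flip: e(2))
      ultimately have "ud_word e" "end_height e = 0" using l h c by (auto simp: ud_word_def)
      then show False using More e(2) xy(3) by (metis valid.simps(2))
    qed
  qed
  then show "valid t \<Longrightarrow> irreducible_word (ud_word_of t)"
    by (simp add: irreducible_word_def ud_word_ud_word_of)
qed

lemma irreducible_word_imp_ud_word_of:
  "irreducible_word w \<Longrightarrow> \<exists>t. valid t \<and> w = ud_word_of t"
proof (induction w rule: length_induct)
  case (1 w)
  have w: "ud_word w" "end_height w = 0"
    using 1(2) by (auto simp: irreducible_word_def)
  have irr: "\<not> (ud_word x \<and> ud_word y \<and> end_height x = 0)" if "w = x @ y" for x y
    using that 1(2) by (auto simp: irreducible_word_def)
  obtain w1 where w1: "w = U # w1" using w(1) by (cases w) (auto simp: ud_word_def)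
  \<comment> \<open>The first return of \<open>w\<close> to the axis is found as a first passage of
    the flipped path.\<close>
  have "\<not> below 0 (map flip w1)"
    using w(2) w1 end_height_le_of_below[of 0 "map flip w1"] by auto
  then obtain a r' where a: "map flip w1 = a @ U # r'" "below 0 a" "end_height a = 0"
    using first_passage by (metis order_refl)
  define r where "r = map flip r'"
  have "w1 = map flip a @ D # r"
    using arg_cong[OF a(1), of "map flip"] by (simp add: r_def del: map_map)
  then have w2: "w = (U # map flip a @ [D]) @ r" using w1 by simp
  show ?case
  proof (cases "r = []")
    case True
    then show ?thesis
      using w2 a by (intro exI[of _ "Last a"]) (auto simp: nonpos_bridge_def)
  next
    case False
    have lr: "last r = D" using w(1) False w2 by (auto simp: ud_word_def)
    have hr: "end_height r = 0" using w(2) w2 a by simp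
    \<comment> \<open>Irreducibility is used here: the first return is not a valley, so the path
      continues below the axis.\<close>
    have "\<not> ud_word r" using irr[OF w2] a by (auto simp: ud_word_def)
    then have "hd r \<noteq> U" using False lr by (auto simp: ud_word_def)
    then obtain r1 where r1: "r = D # r1" using False by (cases r; cases "hd r") auto
    have "\<not> below 0 r1" using hr r1 end_height_le_of_below[of 0 r1] by auto
    then obtain b s where b: "r1 = b @ U # s" "below 0 b" "end_height b = 0"
      using first_passage by (metis order_refl)
    have hs: "end_height s = 0" using hr r1 b by simp
    have ls: "s \<noteq> []" "last s = D" using lr unfolding r1 b(1) by (auto split: if_splits)
    \<comment> \<open>The word arrives at its end on the axis by D, hence from above, so a further
      step above the axis exists.\<close>
    have "\<not> below 0 s" using nonpos_not_last_D[of s "[]"] hs ls by auto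
    then obtain c s1 where c: "s = c @ U # s1" "below 0 c" "end_height c = 0"
      using first_passage by (metis order_refl)
    let ?y = "U # s1" and ?x = "(U # map flip a @ [D]) @ D # b @ U # c"
    have wy: "w = ?x @ ?y" using w2 r1 b(1) c(1) by simp
    have hy: "end_height ?y = 0" using hs c by simp
    have udy: "ud_word ?y" using ls c(1) by (simp add: ud_word_def)
    have "\<not> (\<exists>x y. ?y = x @ y \<and> ud_word x \<and> ud_word y \<and> end_height x = 0)"
    proof
      assume "\<exists>x y. ?y = x @ y \<and> ud_word x \<and> ud_word y \<and> end_height x = 0"
      then obtain x y where xy: "?y = x @ y" "ud_word x" "ud_word y" "end_height x = 0" by blast
      moreover have "ud_word (?x @ x)" using xy(2) by (simp add: ud_word_def)
      moreover have "end_height (?x @ x) = 0" using xy(4) a b c by simp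
      ultimately show False using irr[of "?x @ x" y] wy by simp
    qed
    then have "irreducible_word ?y" using hy udy by (simp add: irreducible_word_def)
    moreover have "length ?y < length w" using wy by simp
    ultimately obtain t where "valid t" "?y = ud_word_of t" using 1(1) by blast
    then show ?thesis
      using wy a b c by (intro exI[of _ "More a b c t"]) (auto simp: nonpos_bridge_def)
  qed
qed

section \<open>Pairs of compositions as words\<close>

fun word_of :: "nat list \<Rightarrow> nat list \<Rightarrow> step list" where
  "word_of (x # b) (y # b') = replicate x U @ replicate y D @ word_of b b'"
| "word_of _ _ = []"

text \<open>The sums may differ, so that factors of a word and the unbalanced words arising in the
  decoding induction are covered too.\<close>

definition pos_pair :: "nat list \<Rightarrow> nat list \<Rightarrow> bool" where
  "pos_pair b b' \<longleftrightarrow> length b = length b' \<and> (\<forall>x\<in>set b. 0 < x) \<and> (\<forall>x\<in>set b'. 0 < x)"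

lemma pos_pair_simps [simp]:
  "pos_pair [] b' \<longleftrightarrow> b' = []"
  "pos_pair (x # b) (y # b') \<longleftrightarrow> 0 < x \<and> 0 < y \<and> pos_pair b b'"
  "pos_pair (x # b) [] \<longleftrightarrow> False"
  by (auto simp: pos_pair_def)

lemma word_of_append: "length b = length b' \<Longrightarrow> word_of (b @ c) (b' @ c') = word_of b b' @ word_of c c'"
  by (induction b b' rule: list_induct2) auto

lemma end_height_word_of:
  "length b = length b' \<Longrightarrow> end_height (word_of b b') = int (sum_list b) - int (sum_list b')"
  by (induction b b' rule: list_induct2) auto

lemma length_word_of:
  "length b = length b' \<Longrightarrow> length (word_of b b') = sum_list b + sum_list b'"
  by (induction b b' rule: list_induct2) auto

lemma ud_word_word_of: "pos_pair b b' \<Longrightarrow> b \<noteq> [] \<Longrightarrow> ud_word (word_of b b')"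
proof (induction b b' rule: word_of.induct)
  case (1 x b y b')
  show ?case
    using 1
    by (cases "b = []"; cases x; cases y)
      (auto simp: ud_word_def hd_append last_append simp flip: replicate_append_same)
qed (auto simp: pos_pair_def)

text \<open>The side conditions make the two runs maximal, so \<open>takeWhile\<close> recovers
  their lengths.\<close>

lemma replicate_U_D_inject:
  assumes "replicate x U @ replicate y D @ r = replicate x' U @ replicate y' D @ r'"
    "0 < y" "0 < y'" "r = [] \<or> hd r = U" "r' = [] \<or> hd r' = U"
  shows "x = x' \<and> y = y' \<and> r = r'"
proof -
  have tw: "takeWhile (\<lambda>s. s = U) (replicate x U @ replicate y D @ r) = replicate x U"
    if "0 < y" for x y r
    using that by (induction x) (auto simp: gr0_conv_Suc)
  have tw': "takeWhile (\<lambda>s. s = D) (replicate y D @ r) = replicate y D" if "r = [] \<or> hd r = U" for y r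
    using that by (induction y) (cases r; auto)+
  have x: "x = x'" using tw[OF assms(2), of x r] tw[OF assms(3), of x' r'] assms(1)
    by (metis length_replicate)
  then have eq: "replicate y D @ r = replicate y' D @ r'" using assms(1) by simp
  then have y: "y = y'" using tw'[OF assms(4), of y] tw'[OF assms(5), of y']
    by (metis length_replicate)
  show ?thesis using x y eq by simp
qed

lemma word_of_inject:
  assumes "pos_pair b b'" "pos_pair c c'" "word_of b b' = word_of c c'"
  shows "b = c \<and> b' = c'"
  using assms
proof (induction b b' arbitrary: c c' rule: word_of.induct)
  case (1 x b y b')
  have "ud_word (word_of (x # b) (y # b'))" using 1(2) by (intro ud_word_word_of) auto
  then have "word_of c c' \<noteq> []" unfolding 1(4) by (simp add: ud_word_def)
  then obtain z d z' d' where c: "c = z # d" "c' = z' # d'"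
    by (cases c; cases c') auto
  have "word_of e e' = [] \<or> hd (word_of e e') = U" if "pos_pair e e'" for e e'
    using that ud_word_word_of[of e e'] by (cases "e = []") (auto simp: ud_word_def)
  then have "x = z \<and> y = z' \<and> word_of b b' = word_of d d'"
    using 1 c by (intro replicate_U_D_inject) auto
  then show ?case using 1 c by auto
next
  case ("2_1" b')
  then show ?case using ud_word_word_of[of c c'] by (cases c) (auto simp: ud_word_def)
next
  case ("2_2" b)
  then show ?case
    using ud_word_word_of[of c c'] by (cases b; cases c) (auto simp: ud_word_def)
qed

text \<open>Decoding by the first steps: \<open>UU\<close> enlarges the first up run,
  \<open>UDU\<close> closes a block of two ones, and \<open>UDD\<close> is reduced by deleting one
  D.\<close>

lemma ud_word_imp_word_of: "ud_word w \<Longrightarrow> \<exists>b b'. pos_pair b b' \<and> b \<noteq> [] \<and> w = word_of b b'"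
proof (induction w rule: length_induct)
  case (1 w)
  obtain w1 where w1: "w = U # w1" "w1 \<noteq> []" "last w1 = D"
    using 1(2) by (cases w) (auto simp: ud_word_def split: if_splits)
  have IH: "\<exists>b b'. pos_pair b b' \<and> b \<noteq> [] \<and> v = word_of b b'"
    if "ud_word v" "length v < length w" for v
    using 1(1) that by blast
  show ?case
  proof (cases "hd w1")
    case U
    then obtain b b' where b: "pos_pair b b'" "b \<noteq> []" "w1 = word_of b b'"
      using IH[of w1] w1 by (auto simp: ud_word_def)
    then obtain x c y c' where "b = x # c" "b' = y # c'"
      by (cases b; cases b') auto
    then show ?thesis
      using b w1 by (intro exI[of _ "Suc x # c"] exI[of _ "y # c'"]) auto
  next
    case D
    then obtain w2 where w2: "w1 = D # w2" using w1(2) by (cases w1) auto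
    consider "w2 = []" | "w2 \<noteq> []" "hd w2 = U" | "w2 \<noteq> []" "hd w2 = D"
      by (cases "hd w2") auto
    then show ?thesis
    proof cases
      case 1
      then show ?thesis
        using w1 w2 by (intro exI[of _ "[1]"] exI[of _ "[1]"]) auto
    next
      case 2
      then obtain b b' where "pos_pair b b'" "b \<noteq> []" "w2 = word_of b b'"
        using IH[of w2] w1 w2 by (auto simp: ud_word_def)
      then show ?thesis
        using w1 w2 by (intro exI[of _ "1 # b"] exI[of _ "1 # b'"]) auto
    next
      case 3
      then obtain b b' where b: "pos_pair b b'" "b \<noteq> []" "U # w2 = word_of b b'"
        using IH[of "U # w2"] w1 w2 by (auto simp: ud_word_def)
      then obtain x c y c' where c: "b = x # c" "b' = y # c'"
        by (cases b; cases b') auto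
      then obtain x' where x: "x = Suc x'" using b(1) by (cases x) auto
      \<comment> \<open>As \<open>w2\<close> begins with D, the first up run of
        \<open>U # w2\<close> has length one.\<close>
      have "x' = 0"
        using 3 b(3) c x by (cases x') auto
      then show ?thesis
        using b c x w1 w2 by (intro exI[of _ "1 # c"] exI[of _ "Suc y # c'"]) auto
    qed
  qed
qed

text \<open>Valleys of the word are the boundaries between blocks, and the height at a boundary is
  the difference of the two partial sums. Injectivity of \<open>word_of\<close> turns a
  factorisation of the word into one of the lists.\<close>

lemma irreducible_word_of_iff:
  assumes "pos_pair b b'" "b \<noteq> []" "sum_list b = sum_list b'"
  shows "irreducible_word (word_of b b') \<longleftrightarrow>
    \<not> (\<exists>j. 0 < j \<and> j < length b \<and> sum_list (take j b) = sum_list (take j b'))"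
proof -
  have len: "length b = length b'" using assms(1) by (simp add: pos_pair_def)
  have "(\<exists>x y. word_of b b' = x @ y \<and> ud_word x \<and> ud_word y \<and> end_height x = 0) \<longleftrightarrow>
    (\<exists>j. 0 < j \<and> j < length b \<and> sum_list (take j b) = sum_list (take j b'))" (is "?l \<longleftrightarrow> ?r")
  proof
    assume ?l
    then obtain x y where xy: "word_of b b' = x @ y" "ud_word x" "ud_word y" "end_height x = 0"
      by blast
    then obtain c c' d d' where c: "pos_pair c c'" "c \<noteq> []" "x = word_of c c'"
      and d: "pos_pair d d'" "d \<noteq> []" "y = word_of d d'"
      using ud_word_imp_word_of by metis
    have lc: "length c = length c'" using c(1) by (simp add: pos_pair_def)
    then have "word_of b b' = word_of (c @ d) (c' @ d')"
      using xy c d by (simp add: word_of_append)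
    moreover have "pos_pair (c @ d) (c' @ d')" using c(1) d(1) by (auto simp: pos_pair_def)
    ultimately have "b = c @ d" "b' = c' @ d'" using word_of_inject assms(1) by blast+
    moreover have "sum_list c = sum_list c'"
      using xy(4) c(3) end_height_word_of[OF lc] by simp
    ultimately show ?r
      using c(2) d(2) lc by (intro exI[of _ "length c"]) auto
  next
    assume ?r
    then obtain j where j: "0 < j" "j < length b" "sum_list (take j b) = sum_list (take j b')"
      by blast
    have "word_of b b' = word_of (take j b) (take j b') @ word_of (drop j b) (drop j b')"
      using len word_of_append[of "take j b" "take j b'" "drop j b" "drop j b'"] by simp
    moreover have "pos_pair (take j b) (take j b')" "pos_pair (drop j b) (drop j b')"
      using assms(1) by (auto simp: pos_pair_def dest: in_set_takeD in_set_dropD)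
    then have "ud_word (word_of (take j b) (take j b'))" "ud_word (word_of (drop j b) (drop j b'))"
      using j assms(2) by (auto intro!: ud_word_word_of)
    moreover have "end_height (word_of (take j b) (take j b')) = 0"
      using j(3) len by (simp add: end_height_word_of)
    ultimately show ?l by blast
  qed
  then show ?thesis
    using assms len ud_word_word_of by (auto simp: irreducible_word_def end_height_word_of)
qed

lemma card_irreducible_composition_pairs:
  "card (irreducible_composition_pairs n) = card {w. irreducible_word w \<and> length w = 2 * n}"
proof -
  have mem: "(b, b') \<in> irreducible_composition_pairs n \<longleftrightarrow>
    pos_pair b b' \<and> b \<noteq> [] \<and> sum_list b = n \<and> sum_list b' = n \<and> irreducible_word (word_of b b')"
    for b b'
    using irreducible_word_of_iff[of b b']
    by (auto simp: irreducible_composition_pairs_def compositions_def pos_pair_def Suc_le_eq)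
  have "bij_betw (\<lambda>(b, b'). word_of b b') (irreducible_composition_pairs n)
    {w. irreducible_word w \<and> length w = 2 * n}"
    unfolding bij_betw_def
  proof
    show "inj_on (\<lambda>(b, b'). word_of b b') (irreducible_composition_pairs n)"
      by (auto simp: inj_on_def mem dest: word_of_inject)
    show "(\<lambda>(b, b'). word_of b b') ` irreducible_composition_pairs n =
      {w. irreducible_word w \<and> length w = 2 * n}"
    proof (intro equalityI subsetI)
      fix w assume "w \<in> (\<lambda>(b, b'). word_of b b') ` irreducible_composition_pairs n"
      then show "w \<in> {w. irreducible_word w \<and> length w = 2 * n}"
        by (auto simp: mem pos_pair_def length_word_of)
    next
      fix w assume "w \<in> {w. irreducible_word w \<and> length w = 2 * n}"
      then have w: "irreducible_word w" "length w = 2 * n" by auto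
      then obtain b b' where b: "pos_pair b b'" "b \<noteq> []" "w = word_of b b'"
        using ud_word_imp_word_of unfolding irreducible_word_def by blast
      then have len: "length b = length b'" by (simp add: pos_pair_def)
      have "sum_list b = sum_list b'"
        using w(1) b(3) end_height_word_of[OF len] by (simp add: irreducible_word_def)
      \<comment> \<open>The sums are equal and add up to the length \<open>2 * n\<close>, so each is
        \<open>n\<close>.\<close>
      then have "(b, b') \<in> irreducible_composition_pairs n"
        using w b length_word_of[OF len] by (auto simp: mem)
      then show "w \<in> (\<lambda>(b, b'). word_of b b') ` irreducible_composition_pairs n"
        using b(3) by force
    qed
  qed
  then show ?thesis by (rule bij_betw_same_card)
qed

section \<open>Equality of the counts through the common parse trees\<close>

theorem lemma4p17:
  fixes n :: nat
  assumes "n \<ge> 1"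
  shows "card {w \<in> dyck_bridges n. single_highest_peak w \<and> starts_with_hill w \<and> peaks_preceded w}
       = card (irreducible_composition_pairs n)"
proof -
  let ?T = "{t. valid t \<and> length (bridge_of t) = 2 * n}"
  have "{w \<in> dyck_bridges n. single_highest_peak w \<and> starts_with_hill w \<and> peaks_preceded w}
    = bridge_of ` ?T"
  proof -
    have "single_highest_peak w \<and> starts_with_hill w \<and> peaks_preceded w \<longleftrightarrow> admissible w" for w
      by (simp add: admissible_def)
    then show ?thesis
      using admissible_bridge_of admissible_imp_bridge_of by (fastforce simp: dyck_bridges_def)
  qed
  moreover have "card (bridge_of ` ?T) = card ?T"
    by (rule card_image, rule inj_on_subset[OF inj_on_bridge_of]) auto
  \<comment> \<open>The same set of trees serves for both images because the two words of a tree
    have equal length.\<close>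
  moreover have "{w. irreducible_word w \<and> length w = 2 * n} = ud_word_of ` ?T"
    using irreducible_ud_word_of irreducible_word_imp_ud_word_of
    by (fastforce simp: length_ud_word_of)
  moreover have "card (ud_word_of ` ?T) = card ?T"
    by (rule card_image, rule inj_on_subset[OF inj_on_ud_word_of]) auto
  ultimately show ?thesis by (simp add: card_irreducible_composition_pairs)
qed

end
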